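(* Let the ILRFPP model on $\mathbb{Z}^d$ satisfy the standing assumptions, and suppose $\alpha<d/\gamma$. Fix $x\in\mathbb{Z}^d\setminus\{0\}$ and set $n:=\|x\|$. For $m\ge1$ define the annulus $A_m:=\{z\in\mathbb{Z}^d: m\le\|z\|<2m\}$. Then there exists a random sequence of vertices $y_k\in A_{2^kn}$, $k\ge1$, such that $$W_{0y_k}+W_{y_kx}\longrightarrow0\quad\text{almost surely as }k\to\infty.$$ In particular $T(0,x)=0$ almost surely.
   Context: Model (inhomogeneous long-range first-passage percolation, ILRFPP). Fix an integer $d\ge1$ and $\alpha>0$; $\|\cdot\|$ is the $\ell_1$ norm on $\mathbb{Z}^d$. The vertex weights $(V_x)_{x\in\mathbb{Z}^d}$ are i.i.d. with the law of a random variable $V$; the edge noises $\omega_{xy}=\omega_{yx}\ge0$, one for every unordered pair $\{x,y\}$ of distinct vertices of $\mathbb{Z}^d$ (all pairs are edges), are i.i.d. with the law of $\omega$, and independent of the vertex weights. The passage time of an edge is $W_{xy}:=\|x-y\|^{\alpha}\,\omega_{xy}/(V_xV_y)$. A path is a finite sequence of distinct vertices; its passage time is the sum of $W$ over its consecutive edges. $T(x,y)$ is the infimum of the passage times over all finite self-avoiding paths from $x$ to $y$. Standing assumptions: for fixed $\gamma,\theta,\zeta>0$, $\mathbb{P}(0<V<\infty)=1$ and $\lim_{x\to\infty}\log\mathbb{P}(V\ge x)/\log x=-\gamma$; $\lim_{x\downarrow0}\log\mathbb{P}(\omega\le x)/\log x=\theta$ and $\mathbb{E}\,\omega^{\zeta}<\infty$.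 *)

theory Defs
  imports "HOL-Probability.Probability"
begin

text \<open>
  Inhomogeneous long-range first-passage percolation on \<open>\<int>\<^sup>d\<close>. The lattice is the type
  \<open>int ^ 'd\<close>, so that \<open>d = CARD('d) \<ge> 1\<close>.
\<close>

definition l1norm :: "int ^ 'd::finite \<Rightarrow> nat" where
  "l1norm x = (\<Sum>i\<in>UNIV. nat \<bar>x $ i\<bar>)"

definition annulus :: "nat \<Rightarrow> (int ^ 'd::finite) set" where
  "annulus m = {z. m \<le> l1norm z \<and> l1norm z < 2 * m}"

text \<open>An edge is an unordered pair of distinct vertices, represented as a two-element set.\<close>

definition edges :: "(int ^ 'd::finite) set set" where
  "edges = {{x, y} | x y. x \<noteq> y}"

text \<open>
  The weights \<open>V v\<close> and the noises \<open>\<omega> e\<close> are real random variables on the probability space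
  \<open>M\<close>, with common laws \<open>\<nu>V\<close> and \<open>\<nu>\<omega>\<close>. The joint family of all weights and all noises is
  mutually independent; this includes their measurability. The values of \<open>\<omega>\<close> off \<open>edges\<close> are
  irrelevant.
\<close>

locale ilrfpp = prob_space M
  for M :: "'a measure" +
  fixes \<alpha> :: real
    and V :: "int ^ 'd::finite \<Rightarrow> 'a \<Rightarrow> real"
    and \<omega> :: "(int ^ 'd) set \<Rightarrow> 'a \<Rightarrow> real"
    and \<nu>V \<nu>\<omega> :: "real measure"
  assumes alpha_pos: "0 < \<alpha>"
    and indep: "indep_vars (\<lambda>_. borel) (case_sum V \<omega>) (UNIV <+> edges)"
    and law_V: "\<And>v. distr M borel (V v) = \<nu>V"
    and law_\<omega>: "\<And>e. e \<in> edges \<Longrightarrow> distr M borel (\<omega> e) = \<nu>\<omega>"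
    and \<omega>_nonneg: "AE t in \<nu>\<omega>. 0 \<le> t"

text \<open>
  The convention \<open>ln 0 = 0\<close> is harmless in the two limits: if one of the probabilities vanished
  for some argument, then by monotonicity it would vanish from there on, and the quotient would
  tend to \<open>0\<close>, which is excluded by \<open>\<gamma> > 0\<close> and \<open>\<theta> > 0\<close>. Finiteness of the weights is
  automatic for real-valued variables.
\<close>

definition standing_assumptions ::
    "real measure \<Rightarrow> real measure \<Rightarrow> real \<Rightarrow> real \<Rightarrow> real \<Rightarrow> bool" where
  "standing_assumptions \<nu>V \<nu>\<omega> \<gamma> \<theta> \<zeta> \<longleftrightarrow>
     0 < \<gamma> \<and> 0 < \<theta> \<and> 0 < \<zeta> \<and>
     (AE t in \<nu>V. 0 < t) \<and>
     ((\<lambda>t. ln (measure \<nu>V {t..}) / ln t) \<longlongrightarrow> - \<gamma>) at_top \<and>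
     ((\<lambda>t. ln (measure \<nu>\<omega> {..t}) / ln t) \<longlongrightarrow> \<theta>) (at_right 0) \<and>
     integrable \<nu>\<omega> (\<lambda>t. t powr \<zeta>)"

text \<open>The last argument of the following random quantities is the sample point.\<close>

definition edge_time ::
    "real \<Rightarrow> (int ^ 'd::finite \<Rightarrow> 'a \<Rightarrow> real) \<Rightarrow> ((int ^ 'd) set \<Rightarrow> 'a \<Rightarrow> real) \<Rightarrow>
     int ^ 'd \<Rightarrow> int ^ 'd \<Rightarrow> 'a \<Rightarrow> real" where
  "edge_time \<alpha> V \<omega> x y s = real (l1norm (x - y)) powr \<alpha> * \<omega> {x, y} s / (V x s * V y s)"

definition path_time ::
    "real \<Rightarrow> (int ^ 'd::finite \<Rightarrow> 'a \<Rightarrow> real) \<Rightarrow> ((int ^ 'd) set \<Rightarrow> 'a \<Rightarrow> real) \<Rightarrow>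
     (int ^ 'd) list \<Rightarrow> 'a \<Rightarrow> real" where
  "path_time \<alpha> V \<omega> p s = (\<Sum>i<length p - 1. edge_time \<alpha> V \<omega> (p ! i) (p ! Suc i) s)"

definition paths :: "int ^ 'd::finite \<Rightarrow> int ^ 'd \<Rightarrow> (int ^ 'd) list set" where
  "paths x y = {p. p \<noteq> [] \<and> distinct p \<and> hd p = x \<and> last p = y}"

text \<open>Taken in \<open>ereal\<close> so that the infimum is a genuine one at every sample point.\<close>

definition first_passage_time ::
    "real \<Rightarrow> (int ^ 'd::finite \<Rightarrow> 'a \<Rightarrow> real) \<Rightarrow> ((int ^ 'd) set \<Rightarrow> 'a \<Rightarrow> real) \<Rightarrow>
     int ^ 'd \<Rightarrow> int ^ 'd \<Rightarrow> 'a \<Rightarrow> ereal" where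
  "first_passage_time \<alpha> V \<omega> x y s = (INF p\<in>paths x y. ereal (path_time \<alpha> V \<omega> p s))"

end

theory Submission
  imports Defs "HOL-Real_Asymp.Real_Asymp"
begin

text \<open>
  The vertex \<open>y\<^sub>k\<close> is a hub far away from both endpoints. Choose \<open>\<beta>\<close> with \<open>\<alpha> < \<beta> < d / \<gamma>\<close> and a
  level \<open>c\<close> which the noise \<open>\<omega>\<close> stays below with positive probability. Call a vertex \<open>z\<close> at distance
  about \<open>m\<close> a bridge if \<open>V z \<ge> m\<close> to the power \<open>\<beta>\<close> and both edges from \<open>z\<close> to the endpoints \<open>0\<close> and
  \<open>x\<close> have noise at most \<open>c\<close>. The two edges at a bridge cost at most a constant times
  \<open>1 / V 0 + 1 / V x\<close> times \<open>m\<close> to the power \<open>\<alpha> - \<beta>\<close> (lemma \<open>bridge_cost_le\<close>), which tends to \<open>0\<close>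
  for almost every sample point.

  Bridges exist because of the competition between volume and tail. The annulus of scale \<open>m\<close> has at
  least \<open>(m / d)\<^sup>d\<close> vertices (\<open>card_annulus_ge\<close>), and a vertex is a bridge with probability roughly
  \<open>m\<close> to the power \<open>- \<beta> \<gamma>\<close>, where \<open>\<beta> \<gamma> < d\<close>. These events are independent for different vertices
  (\<open>prob_no_bridge\<close>), so the annulus contains no bridge with a probability that is exponentially
  small in a power of \<open>m\<close>. Along the scales \<open>2 ^ k * n\<close> this is summable, and the Borel-Cantelli
  lemma yields a bridge at all large scales (\<open>AE_eventually_bridge\<close>). A measurable choice among the
  bridges of the \<open>k\<close>-th annulus is \<open>y\<^sub>k\<close>. The path \<open>0, y\<^sub>k, x\<close> then bounds the first passage time from
  above, and all passage times are nonnegative almost surely.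
\<close>

section \<open>The norm and the size of an annulus\<close>

lemma l1norm_eq_0_iff: "l1norm z = 0 \<longleftrightarrow> z = 0"
  by (auto simp: l1norm_def vec_eq_iff)

lemma l1norm_minus_commute: "l1norm (x - y) = l1norm (y - x)"
  by (simp add: l1norm_def abs_minus_commute)

lemma l1norm_diff_le: "l1norm (x - y) \<le> l1norm x + l1norm y"
proof -
  have "l1norm (x - y) \<le> (\<Sum>i\<in>UNIV. nat \<bar>x $ i\<bar> + nat \<bar>y $ i\<bar>)"
    unfolding l1norm_def by (intro sum_mono) auto
  then show ?thesis by (simp add: l1norm_def sum.distrib)
qed

lemma finite_annulus: "finite (annulus m :: (int ^ 'd::finite) set)"
proof (rule finite_subset)
  show "(annulus m :: (int ^ 'd) set) \<subseteq> vec_lambda ` (UNIV \<rightarrow>\<^sub>E {- 2 * int m..2 * int m})"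
  proof
    fix z :: "int ^ 'd" assume z: "z \<in> annulus m"
    have "z $ i \<in> {- 2 * int m..2 * int m}" for i
    proof -
      have "nat \<bar>z $ i\<bar> \<le> l1norm z" unfolding l1norm_def by (rule member_le_sum) auto
      then show ?thesis using z by (auto simp: annulus_def)
    qed
    then have "vec_nth z \<in> UNIV \<rightarrow>\<^sub>E {- 2 * int m..2 * int m}" by auto
    then show "z \<in> vec_lambda ` (UNIV \<rightarrow>\<^sub>E {- 2 * int m..2 * int m})"
      by (metis imageI vec_nth_inverse)
  qed
qed (intro finite_imageI finite_PiE, auto)

text \<open>
  A cube of side about \<open>m / d\<close> with corner at distance \<open>m\<close> on a coordinate axis fits into the
  annulus. The order \<open>m\<^sup>d\<close> of the number of its vertices is sharp, the constant is not.
\<close>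

lemma card_annulus_ge:
  "(real m / real CARD('d)) ^ CARD('d) \<le> real (card (annulus m :: (int ^ 'd::finite) set))"
proof (cases "m = 0")
  case False
  define d where "d = CARD('d)"
  \<comment> \<open>The largest side \<open>r\<close> for which the \<open>d\<close> coordinates, each at most \<open>r - 1\<close>, add less than \<open>m\<close>
      to the norm of the corner; still \<open>m \<le> r d\<close>.\<close>
  define r where "r = (m - 1) div d + 1"
  define i0 :: 'd where "i0 = undefined"
  define f :: "('d \<Rightarrow> nat) \<Rightarrow> int ^ 'd"
    where "f g = (\<chi> i. int (g i + (if i = i0 then m else 0)))" for g
  have d: "d > 0" by (simp add: d_def)
  have r_upper: "d * (r - 1) < m"
    using False by (simp add: r_def)
      (metis Suc_pred div_times_less_eq_dividend le_imp_less_Suc mult.commute)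
  have r_lower: "m \<le> r * d"
    using dividend_less_div_times[OF d, of "m - 1"] False by (simp add: r_def)
  have norm: "l1norm (f g) = sum g UNIV + m" for g
    by (simp add: l1norm_def f_def sum.distrib flip: of_nat_add)
  have inj: "inj_on f (UNIV \<rightarrow>\<^sub>E {..<r})"
    by (auto simp: inj_on_def f_def vec_eq_iff fun_eq_iff)
  have "f ` (UNIV \<rightarrow>\<^sub>E {..<r}) \<subseteq> annulus m"
  proof
    fix z assume "z \<in> f ` (UNIV \<rightarrow>\<^sub>E {..<r})"
    then obtain g where g: "z = f g" "g \<in> UNIV \<rightarrow>\<^sub>E {..<r}" by auto
    have "sum g UNIV \<le> (\<Sum>i\<in>(UNIV::'d set). r - 1)"
    proof (rule sum_mono)
      fix i :: 'd
      have "g i < r" using g(2) by auto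
      then show "g i \<le> r - 1" by simp
    qed
    then have "sum g UNIV < m" using r_upper by (simp add: d_def)
    then show "z \<in> annulus m" by (simp add: annulus_def norm g)
  qed
  then have "card (f ` (UNIV \<rightarrow>\<^sub>E {..<r})) \<le> card (annulus m :: (int ^ 'd) set)"
    by (intro card_mono finite_annulus)
  then have "r ^ d \<le> card (annulus m :: (int ^ 'd) set)"
    by (simp add: card_image[OF inj] card_PiE d_def)
  then have "real r ^ d \<le> real (card (annulus m :: (int ^ 'd) set))"
    by (metis of_nat_le_iff of_nat_power)
  moreover have "(real m / real d) ^ d \<le> real r ^ d"
  proof (rule power_mono)
    have "real m \<le> real r * real d" using r_lower by (metis of_nat_le_iff of_nat_mult)
    then show "real m / real d \<le> real r" using d by (simp add: divide_simps)
  qed simp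
  ultimately show ?thesis unfolding d_def by linarith
qed (simp add: power_0_left)

lemma annulus_nonempty:
  assumes "0 < m"
  shows "annulus m \<noteq> ({} :: (int ^ 'd::finite) set)"
proof
  assume "annulus m = ({} :: (int ^ 'd) set)"
  moreover have "0 < (real m / real CARD('d)) ^ CARD('d)" using assms by simp
  ultimately show False using card_annulus_ge[of m, where 'd = 'd] by simp
qed

lemma annulus_avoids_endpoints:
  assumes "x \<noteq> 0" "2 * l1norm x \<le> m"
  shows "0 \<notin> annulus m" "x \<notin> annulus m"
proof -
  have "0 < l1norm x" using assms(1) by (simp add: zero_less_iff_neq_zero l1norm_eq_0_iff)
  then show "0 \<notin> annulus m" "x \<notin> annulus m"
    using assms(2) by (auto simp: annulus_def l1norm_def[of 0])
qed

section \<open>Tools from probability and analysis\<close>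

text \<open>
  Makes the choice of the intermediate vertex a random variable: run through the finitely many
  candidates in a fixed order and take the first one that satisfies the predicate, or the last
  candidate when there is none.
\<close>

lemma exists_measurable_selection:
  assumes "finite A" "A \<noteq> {}" and "\<And>a. a \<in> A \<Longrightarrow> Measurable.pred M (P a)"
  shows "\<exists>y \<in> measurable M (count_space UNIV).
           (\<forall>s. y s \<in> A) \<and> (\<forall>s. (\<exists>a\<in>A. P a s) \<longrightarrow> P (y s) s)"
  using assms
proof (induction A rule: finite_ne_induct)
  case (singleton a)
  show ?case by (rule bexI[of _ "\<lambda>_. a"]) auto
next
  case (insert a A)
  then obtain y where y: "y \<in> measurable M (count_space UNIV)" "\<And>s. y s \<in> A"
    "\<And>s. \<exists>b\<in>A. P b s \<Longrightarrow> P (y s) s" by auto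
  have [measurable]: "Measurable.pred M (P a)" using insert.prems by simp
  have "(\<lambda>s. if P a s then a else y s) \<in> measurable M (count_space UNIV)"
    using y(1) by measurable
  then show ?case using y(2,3) by (intro bexI[of _ "\<lambda>s. if P a s then a else y s"]) auto
qed

text \<open>
  Disjoint blocks of an independent family are independent, so the failures of the blocks
  (some coordinate misses its target set) are independent; within one block, independence evaluates the
  complementary event. Both steps use the same family \<open>X\<close>, first grouped into random vectors and
  then coordinate by coordinate.
\<close>

lemma (in prob_space) prob_all_blocks_fail:
  assumes ind: "indep_vars (\<lambda>_. N) X I"
    and K: "\<And>j. j \<in> L \<Longrightarrow> finite (K j) \<and> K j \<noteq> {} \<and> K j \<subseteq> I"
    and disj: "disjoint_family_on K L"
    and L: "finite L" "L \<noteq> {}"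
    and E: "\<And>i. E i \<in> sets N"
  shows "prob {s \<in> space M. \<forall>j\<in>L. \<exists>i\<in>K j. X i s \<notin> E i} =
           (\<Prod>j\<in>L. 1 - (\<Prod>i\<in>K j. prob {s \<in> space M. X i s \<in> E i}))"
proof -
  define Y where "Y j s = restrict (\<lambda>i. X i s) (K j)" for j s
  \<comment> \<open>The failure of block \<open>j\<close> as a measurable set of values of the random vector \<open>Y j\<close>.\<close>
  define B where "B j = space (Pi\<^sub>M (K j) (\<lambda>_. N)) - Pi\<^sub>E (K j) E" for j
  have rv: "X i \<in> measurable M N" if "i \<in> I" for i
    using ind that by (simp add: indep_vars_def)
  have indY: "indep_vars (\<lambda>j. Pi\<^sub>M (K j) (\<lambda>_. N)) Y L"
    unfolding Y_def using K by (intro indep_vars_restrict[OF ind _ disj]) auto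
  have B: "B j \<in> sets (Pi\<^sub>M (K j) (\<lambda>_. N))" if "j \<in> L" for j
    unfolding B_def using K[OF that] E by (intro sets.compl_sets sets_PiM_I_finite) auto
  have preimage: "Y j -` B j \<inter> space M = {s \<in> space M. \<exists>i\<in>K j. X i s \<notin> E i}" if "j \<in> L" for j
  proof -
    have "X i s \<in> space N" if "i \<in> K j" "s \<in> space M" for i s
      using K[OF \<open>j \<in> L\<close>] that by (intro measurable_space[OF rv]) auto
    then show ?thesis by (fastforce simp: Y_def B_def space_PiM PiE_iff)
  qed
  have single: "prob {s \<in> space M. \<exists>i\<in>K j. X i s \<notin> E i} =
      1 - (\<Prod>i\<in>K j. prob {s \<in> space M. X i s \<in> E i})" if "j \<in> L" for j
  proof -
    have sets: "{s \<in> space M. X i s \<in> E i} \<in> events" if "i \<in> K j" for i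
    proof -
      have [measurable]: "X i \<in> measurable M N" "E i \<in> sets N"
        using K[OF \<open>j \<in> L\<close>] that E by (auto intro: rv)
      show ?thesis by measurable
    qed
    have inter: "(\<Inter>i\<in>K j. X i -` E i \<inter> space M) = {s \<in> space M. \<forall>i\<in>K j. X i s \<in> E i}"
      using K[OF that] by auto
    have "prob (\<Inter>i\<in>K j. X i -` E i \<inter> space M) = (\<Prod>i\<in>K j. prob (X i -` E i \<inter> space M))"
      using K[OF that] E by (intro indep_varsD[OF ind]) auto
    then have all: "prob {s \<in> space M. \<forall>i\<in>K j. X i s \<in> E i} =
        (\<Prod>i\<in>K j. prob {s \<in> space M. X i s \<in> E i})"
      unfolding inter by (simp add: vimage_def Int_def conj_commute)
    have "{s \<in> space M. \<forall>i\<in>K j. X i s \<in> E i} \<in> events"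
      using sets K[OF that] by (intro sets.sets_Collect_finite_All') auto
    moreover have "{s \<in> space M. \<exists>i\<in>K j. X i s \<notin> E i} =
        space M - {s \<in> space M. \<forall>i\<in>K j. X i s \<in> E i}" by blast
    ultimately show ?thesis by (simp only: prob_compl all)
  qed
  have "{s \<in> space M. \<forall>j\<in>L. \<exists>i\<in>K j. X i s \<notin> E i} = (\<Inter>j\<in>L. Y j -` B j \<inter> space M)"
    using L preimage by auto
  also have "prob \<dots> = (\<Prod>j\<in>L. prob (Y j -` B j \<inter> space M))"
    using L B by (intro indep_varsD_finite[OF indY]) auto
  finally show ?thesis using preimage single by simp
qed

text \<open>
  The strict inequality \<open>0 < c\<close> matters: it forces \<open>ln (p t)\<close> to be nonzero for large \<open>t\<close>, which
  excludes \<open>p t = 0\<close> in spite of the convention \<open>ln 0 = 0\<close>.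
\<close>

lemma polynomial_tail_lower_bound:
  fixes p :: "real \<Rightarrow> real"
  assumes lim: "((\<lambda>t. ln (p t) / ln t) \<longlongrightarrow> - c) at_top" and "0 < c" "c < c'"
    and nonneg: "\<And>t. 0 \<le> p t"
  shows "eventually (\<lambda>t. t powr - c' \<le> p t) at_top"
proof -
  have "eventually (\<lambda>t. - c' < ln (p t) / ln t) at_top"
    using lim \<open>c < c'\<close> by (intro order_tendstoD) auto
  moreover have "eventually (\<lambda>t. ln (p t) / ln t < 0) at_top"
    using lim \<open>0 < c\<close> by (intro order_tendstoD) auto
  ultimately show ?thesis using eventually_gt_at_top[of 1]
  proof eventually_elim
    case (elim t)
    have "p t \<noteq> 0" using elim(2) by (intro notI) simp
    then have "0 < p t" using nonneg[of t] by simp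
    moreover have "- c' * ln t < ln (p t)" using elim by (simp add: field_simps)
    ultimately show ?case using elim(3)
      by (simp add: powr_def) (metis exp_less_mono exp_ln less_imp_le mult_minus_left)
  qed
qed

text \<open>
  The crude bound \<open>exp (- u) \<le> 1 / u\<close> already gives a geometric series, because the scales double.
\<close>

lemma summable_exp_minus_dyadic:
  fixes c \<delta> r :: real
  assumes "0 < c" "0 < \<delta>" "0 < r"
  shows "summable (\<lambda>k. exp (- (c * (2 ^ k * r) powr \<delta>)))"
proof (rule summable_comparison_test')
  show "summable (\<lambda>k. 1 / (c * r powr \<delta>) * (2 powr - \<delta>) ^ k)"
    using assms
    by (intro summable_mult summable_geometric) (simp add: powr_minus powr_less_one field_simps)
  fix k :: nat
  define u where "u = c * (2 ^ k * r) powr \<delta>"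
  have u: "u > 0" using assms by (simp add: u_def)
  have "exp (- u) \<le> 1 / u"
    using u exp_ge_add_one_self[of u]
    by (simp add: exp_minus inverse_eq_divide del: exp_ge_add_one_self) (intro frac_le; linarith)
  also have "1 / u = 1 / (c * r powr \<delta>) * (2 powr - \<delta>) ^ k"
    using assms
    by (simp add: u_def powr_mult powr_minus powr_power powr_realpow[symmetric] powr_powr field_simps)
  finally show "norm (exp (- u)) \<le> 1 / (c * r powr \<delta>) * (2 powr - \<delta>) ^ k" by simp
qed

section \<open>Bridges between two vertices\<close>

text \<open>
  The vertex \<open>z\<close> carries a large weight and has ordinary noise on both edges that lead to the
  endpoints. No condition is put on the weights of \<open>u\<close> and \<open>v\<close>: this keeps the events for
  different \<open>z\<close> independent.
\<close>

definition bridge ::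
    "(int ^ 'd::finite \<Rightarrow> 'a \<Rightarrow> real) \<Rightarrow> ((int ^ 'd) set \<Rightarrow> 'a \<Rightarrow> real) \<Rightarrow> real \<Rightarrow> real \<Rightarrow>
     int ^ 'd \<Rightarrow> int ^ 'd \<Rightarrow> int ^ 'd \<Rightarrow> 'a \<Rightarrow> bool" where
  "bridge V \<omega> b c u v z s \<longleftrightarrow> b \<le> V z s \<and> \<omega> {u, z} s \<le> c \<and> \<omega> {z, v} s \<le> c"

lemma edges_I: "u \<noteq> v \<Longrightarrow> {u, v} \<in> edges"
  by (auto simp: edges_def)

context ilrfpp
begin

lemma measurable_V [measurable]: "V v \<in> borel_measurable M"
  using indep by (auto simp: indep_vars_def dest!: bspec[where x = "Inl v"])

lemma measurable_\<omega>: "e \<in> edges \<Longrightarrow> \<omega> e \<in> borel_measurable M"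
  using indep by (auto simp: indep_vars_def dest!: bspec[where x = "Inr e"])

lemma countable_edges: "countable (edges :: (int ^ 'd) set set)"
proof (rule countable_subset)
  show "(edges :: (int ^ 'd) set set) \<subseteq> (\<lambda>(u, v). {u, v}) ` UNIV"
    by (auto simp: edges_def)
qed simp

lemma measurable_bridge:
  assumes "u \<noteq> z" "z \<noteq> v"
  shows "Measurable.pred M (bridge V \<omega> b c u v z)"
proof -
  have [measurable]: "\<omega> {u, z} \<in> borel_measurable M" "\<omega> {z, v} \<in> borel_measurable M"
    using assms by (auto intro!: measurable_\<omega> edges_I)
  show ?thesis unfolding bridge_def by measurable
qed

lemma prob_V: "A \<in> sets borel \<Longrightarrow> prob {s \<in> space M. V v s \<in> A} = measure \<nu>V A"
  unfolding law_V[symmetric, of v] by (simp add: measure_distr vimage_def Int_def conj_commute)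

lemma prob_\<omega>:
  "e \<in> edges \<Longrightarrow> A \<in> sets borel \<Longrightarrow> prob {s \<in> space M. \<omega> e s \<in> A} = measure \<nu>\<omega> A"
  using measurable_\<omega>[of e] law_\<omega>[of e, symmetric]
  by (simp add: measure_distr vimage_def Int_def conj_commute)

lemma AE_V_pos:
  assumes "AE t in \<nu>V. 0 < t"
  shows "AE s in M. \<forall>v. 0 < V v s"
proof -
  have "AE s in M. 0 < V v s" for v
    using assms unfolding law_V[symmetric, of v] by (subst (asm) AE_distr_iff) auto
  then show ?thesis by (simp add: AE_all_countable)
qed

lemma AE_\<omega>_nonneg: "AE s in M. \<forall>e\<in>edges. 0 \<le> \<omega> e s"
proof -
  have "AE s in M. 0 \<le> \<omega> e s" if "e \<in> edges" for e
    using \<omega>_nonneg measurable_\<omega>[OF that] unfolding law_\<omega>[OF that, symmetric]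
    by (subst (asm) AE_distr_iff) auto
  then show ?thesis by (subst AE_ball_countable) (auto simp: countable_edges)
qed

text \<open>
  Whether \<open>z\<close> is a bridge depends on the three variables \<open>V z\<close>, \<open>\<omega> {u, z}\<close>, \<open>\<omega> {z, v}\<close>. For
  different \<open>z\<close> outside \<open>{u, v}\<close> these triples share no variable, since \<open>{u, z} = {z', v}\<close> would
  force \<open>z' = u\<close> or \<open>u = v\<close>. So the candidates succeed independently and with equal probability.
\<close>

lemma prob_no_bridge:
  assumes uv: "u \<noteq> v" and Z: "finite Z" "Z \<noteq> {}" "u \<notin> Z" "v \<notin> Z"
  shows "prob {s \<in> space M. \<forall>z\<in>Z. \<not> bridge V \<omega> b c u v z s} =
           (1 - measure \<nu>V {b..} * (measure \<nu>\<omega> {..c})\<^sup>2) ^ card Z"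
proof -
  define K where "K z = {Inl z, Inr {u, z}, Inr {z, v}}" for z :: "int ^ 'd"
  define E :: "(int ^ 'd) + (int ^ 'd) set \<Rightarrow> real set"
    where "E = case_sum (\<lambda>_. {b..}) (\<lambda>_. {..c})"
  let ?X = "case_sum V \<omega>"
  have distinct: "{u, z} \<noteq> {z, v}" for z using uv by (auto simp: doubleton_eq_iff)
  have disj: "disjoint_family_on K Z"
    using uv Z by (auto simp: disjoint_family_on_def K_def doubleton_eq_iff)
  have fail: "(\<exists>i\<in>K z. ?X i s \<notin> E i) \<longleftrightarrow> \<not> bridge V \<omega> b c u v z s" for z s
    by (auto simp: K_def E_def bridge_def)
  have ok: "(\<Prod>i\<in>K z. prob {s \<in> space M. ?X i s \<in> E i}) =
      measure \<nu>V {b..} * (measure \<nu>\<omega> {..c})\<^sup>2" if "z \<in> Z" for z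
  proof -
    have "{u, z} \<in> edges" "{z, v} \<in> edges" using that Z by (auto intro!: edges_I)
    then show ?thesis
      using distinct[of z] prob_V[of "{b..}" z] prob_\<omega>[of "{u, z}" "{..c}"] prob_\<omega>[of "{z, v}" "{..c}"]
      by (simp add: K_def E_def power2_eq_square)
  qed
  have "prob {s \<in> space M. \<forall>z\<in>Z. \<exists>i\<in>K z. ?X i s \<notin> E i} =
      (\<Prod>z\<in>Z. 1 - (\<Prod>i\<in>K z. prob {s \<in> space M. ?X i s \<in> E i}))"
  proof (rule prob_all_blocks_fail[OF indep _ disj])
    show "finite (K z) \<and> K z \<noteq> {} \<and> K z \<subseteq> UNIV <+> edges" if "z \<in> Z" for z
      using that Z by (auto simp: K_def intro!: InrI edges_I)
    show "E i \<in> sets borel" for i by (cases i) (auto simp: E_def)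
  qed (use Z in auto)
  then show ?thesis unfolding fail using ok by simp
qed

lemma prob_no_bridge_le_exp:
  assumes "u \<noteq> v" "finite Z" "Z \<noteq> {}" "u \<notin> Z" "v \<notin> Z"
  shows "prob {s \<in> space M. \<forall>z\<in>Z. \<not> bridge V \<omega> b c u v z s} \<le>
           exp (- (measure \<nu>V {b..} * (measure \<nu>\<omega> {..c})\<^sup>2 * card Z))"
proof -
  interpret \<nu>V: prob_space \<nu>V
    using prob_space_distr[OF measurable_V[of 0]] by (simp add: law_V)
  interpret \<nu>\<omega>: prob_space \<nu>\<omega>
    using prob_space_distr[OF measurable_\<omega>[OF edges_I[OF assms(1)]]]
    by (simp add: law_\<omega> edges_I[OF assms(1)])
  define p where "p = measure \<nu>V {b..} * (measure \<nu>\<omega> {..c})\<^sup>2"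
  have "p \<le> 1" unfolding p_def by (intro mult_le_one power_le_one) auto
  moreover have "1 - p \<le> exp (- p)" using exp_ge_add_one_self[of "- p"] by simp
  ultimately have "(1 - p) ^ card Z \<le> exp (- p) ^ card Z" by (intro power_mono) auto
  also have "\<dots> = exp (- (p * card Z))" by (simp flip: exp_of_nat_mult add: mult.commute)
  finally show ?thesis using prob_no_bridge[OF assms] by (simp add: p_def)
qed

end

section \<open>Passage times of edges and paths\<close>

lemma edge_time_nonneg:
  assumes "\<And>v. 0 < V v s" "\<And>e. e \<in> edges \<Longrightarrow> 0 \<le> \<omega> e s" "u \<noteq> v"
  shows "0 \<le> edge_time \<alpha> V \<omega> u v s"
  using assms less_imp_le[OF assms(1)] unfolding edge_time_def
  by (intro divide_nonneg_nonneg mult_nonneg_nonneg) (auto simp: edges_def)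

lemma edge_time_commute: "edge_time \<alpha> V \<omega> u v s = edge_time \<alpha> V \<omega> v u s"
  by (simp add: edge_time_def l1norm_minus_commute[of u] insert_commute mult.commute)

lemma edge_time_le:
  assumes "0 < V u s" "0 < b" "b \<le> V z s" "0 \<le> \<omega> {u, z} s" "\<omega> {u, z} s \<le> c"
    and "real (l1norm (u - z)) \<le> R" "0 \<le> \<alpha>"
  shows "edge_time \<alpha> V \<omega> u z s \<le> R powr \<alpha> * c / (b * V u s)"
  unfolding edge_time_def
proof (rule frac_le)
  show "real (l1norm (u - z)) powr \<alpha> * \<omega> {u, z} s \<le> R powr \<alpha> * c"
    using assms by (intro mult_mono powr_mono2) auto
  show "0 \<le> R powr \<alpha> * c" using assms by auto
qed (use assms in \<open>auto simp: mult.commute\<close>)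

text \<open>
  The factor in parentheses does not depend on \<open>z\<close>: the weights of the endpoints, however small,
  are only a random constant when the bridge moves to infinity.
\<close>

lemma bridge_cost_le:
  assumes "\<And>v. 0 < V v s" "\<And>e. e \<in> edges \<Longrightarrow> 0 \<le> \<omega> e s"
    and "bridge V \<omega> b c u v z s" "u \<noteq> z" "z \<noteq> v" "0 < b" "0 \<le> \<alpha>"
    and "real (l1norm (u - z)) \<le> R" "real (l1norm (z - v)) \<le> R"
  shows "edge_time \<alpha> V \<omega> u z s + edge_time \<alpha> V \<omega> z v s \<le>
           R powr \<alpha> * c / b * (1 / V u s + 1 / V v s)"
proof -
  have nonneg: "0 \<le> \<omega> {u, z} s" "0 \<le> \<omega> {v, z} s"
    using assms(4,5) by (auto intro!: assms(2) edges_I)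
  have "edge_time \<alpha> V \<omega> u z s \<le> R powr \<alpha> * c / (b * V u s)"
    using assms(1,3,6-8) nonneg by (intro edge_time_le) (auto simp: bridge_def)
  moreover have "edge_time \<alpha> V \<omega> v z s \<le> R powr \<alpha> * c / (b * V v s)"
    using assms(1,3,6,7,9) nonneg
    by (intro edge_time_le) (auto simp: bridge_def l1norm_minus_commute[of v] insert_commute)
  ultimately show ?thesis
    by (simp add: edge_time_commute[of _ _ _ z] distrib_left)
qed

lemma first_passage_time_nonneg:
  assumes "\<And>v. 0 < V v s" "\<And>e. e \<in> edges \<Longrightarrow> 0 \<le> \<omega> e s"
  shows "0 \<le> first_passage_time \<alpha> V \<omega> u v s"
  unfolding first_passage_time_def
proof (rule INF_greatest)
  fix p assume "p \<in> paths u v"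
  then have "distinct p" by (simp add: paths_def)
  then have "0 \<le> path_time \<alpha> V \<omega> p s"
    unfolding path_time_def
    by (intro sum_nonneg edge_time_nonneg assms) (auto simp: nth_eq_iff_index_eq)
  then show "0 \<le> ereal (path_time \<alpha> V \<omega> p s)" by simp
qed

lemma first_passage_time_le_two_edges:
  assumes "distinct [u, z, v]"
  shows "first_passage_time \<alpha> V \<omega> u v s \<le> ereal (edge_time \<alpha> V \<omega> u z s + edge_time \<alpha> V \<omega> z v s)"
proof -
  have "[u, z, v] \<in> paths u v" using assms by (simp add: paths_def)
  moreover have "path_time \<alpha> V \<omega> [u, z, v] s = edge_time \<alpha> V \<omega> u z s + edge_time \<alpha> V \<omega> z v s"
    by (simp add: path_time_def numeral_2_eq_2)
  ultimately show ?thesis unfolding first_passage_time_def by (metis INF_lower)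
qed

section \<open>Bridges at all large dyadic scales\<close>

text \<open>
  The positive exponent \<open>\<theta>\<close> again excludes a vanishing probability, for which the quotient would be
  \<open>0\<close>. With \<open>p\<close> the distribution function of the noise, \<open>c\<close> is the level that defines bridges.
\<close>

lemma exists_level_of_nonzero_prob:
  fixes p :: "real \<Rightarrow> real"
  assumes "((\<lambda>t. ln (p t) / ln t) \<longlongrightarrow> \<theta>) (at_right 0)" "0 < \<theta>"
  obtains c where "0 < c" "p c \<noteq> 0"
proof -
  have "eventually (\<lambda>t. 0 < ln (p t) / ln t) (at_right 0)"
    using assms by (intro order_tendstoD) auto
  moreover have "eventually (\<lambda>t::real. 0 < t) (at_right 0)" by (rule eventually_at_right_less)
  ultimately have "eventually (\<lambda>t. 0 < t \<and> p t \<noteq> 0) (at_right 0)"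
    by eventually_elim auto
  then show thesis using that by (auto dest!: eventually_happens)
qed

text \<open>
  At a large scale \<open>m\<close> there are at least \<open>(m / d)\<^sup>d\<close> independent candidates, each of which succeeds with
  probability at least \<open>m\<close> to the power \<open>- \<beta> g\<close>, up to a constant. The expected number of bridges
  is thus at least of order \<open>m\<close> to the power \<open>\<delta> = d - \<beta> g > 0\<close>. The probability that there is
  none decays exponentially in this number and is summable along the dyadic scales, so the first
  Borel-Cantelli lemma applies.
\<close>

lemma (in ilrfpp) AE_eventually_bridge:
  assumes x: "x \<noteq> 0" and "0 < \<beta>" "\<beta> * g < real CARD('d)"
    and c: "0 < measure \<nu>\<omega> {..c}"
    and tail: "eventually (\<lambda>t. t powr - g \<le> measure \<nu>V {t..}) at_top"
  shows "AE s in M. eventually (\<lambda>k. \<exists>z\<in>annulus (2 ^ k * l1norm x).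
           bridge V \<omega> (real (2 ^ k * l1norm x) powr \<beta>) c 0 x z s) sequentially"
proof -
  define n where "n = l1norm x"
  \<comment> \<open>The scales start at \<open>2 n\<close>: the annulus of scale \<open>n\<close> contains the endpoint \<open>x\<close>.\<close>
  define m where "m k = 2 ^ Suc k * n" for k
  define d where "d = real CARD('d)"
  define \<delta> where "\<delta> = d - \<beta> * g"
  define q where "q = (measure \<nu>\<omega> {..c})\<^sup>2 / d ^ CARD('d)"
  define F where "F k = {s \<in> space M. \<forall>z\<in>annulus (m k).
      \<not> bridge V \<omega> (real (m k) powr \<beta>) c 0 x z s}" for k
  have n: "0 < n" using x by (simp add: n_def zero_less_iff_neq_zero l1norm_eq_0_iff)
  have d: "0 < d" by (simp add: d_def)
  have q: "0 < q" using c d by (simp add: q_def)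
  have \<delta>: "0 < \<delta>" using assms by (simp add: \<delta>_def d_def)
  have m: "0 < m k" "2 * n \<le> m k" for k using n by (auto simp: m_def)
  have avoid: "0 \<notin> annulus (m k)" "x \<notin> annulus (m k)" for k
    using annulus_avoids_endpoints[OF x, of "m k"] m(2)[of k] by (auto simp: n_def)
  have nonempty: "annulus (m k) \<noteq> ({} :: (int ^ 'd) set)" for k
    using m(1) by (rule annulus_nonempty)
  have F: "F k \<in> events" for k
    unfolding F_def using avoid[of k]
    by (intro sets.sets_Collect_finite_All' sets.sets_Collect_neg)
       (auto intro!: measurable_bridge[THEN predE] finite_annulus nonempty)
  have m_real: "real (m k) = 2 ^ k * (2 * real n)" for k by (simp add: m_def)
  have m_top: "filterlim (\<lambda>k. real (m k) powr \<beta>) at_top sequentially"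
    unfolding m_real using n \<open>0 < \<beta>\<close> by real_asymp
  have "eventually (\<lambda>k. norm (prob (F k)) \<le> exp (- (q * (2 ^ k * (2 * real n)) powr \<delta>))) sequentially"
    using eventually_compose_filterlim[OF tail m_top]
  proof eventually_elim
    case (elim k)
    define p where "p = measure \<nu>V {real (m k) powr \<beta>..}"
    have "real (m k) powr - (\<beta> * g) \<le> p" using elim by (simp add: p_def powr_powr)
    then have "real (m k) powr - (\<beta> * g) * (measure \<nu>\<omega> {..c})\<^sup>2 * (real (m k) / d) ^ CARD('d)
        \<le> p * (measure \<nu>\<omega> {..c})\<^sup>2 * real (card (annulus (m k) :: (int ^ 'd) set))"
      using card_annulus_ge[of "m k", where 'd = 'd] by (intro mult_mono) (auto simp: d_def p_def)
    moreover have "real (m k) powr \<delta> = real (m k) ^ CARD('d) * real (m k) powr - (\<beta> * g)"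
      using m(1)[of k] by (simp add: \<delta>_def d_def powr_diff powr_minus powr_realpow divide_inverse)
    ultimately have "q * real (m k) powr \<delta>
        \<le> p * (measure \<nu>\<omega> {..c})\<^sup>2 * real (card (annulus (m k) :: (int ^ 'd) set))"
      by (simp add: q_def power_divide field_simps)
    then have "prob (F k) \<le> exp (- (q * real (m k) powr \<delta>))"
      using prob_no_bridge_le_exp[OF x[symmetric] finite_annulus nonempty avoid[of k], of "real (m k) powr \<beta>" c]
      unfolding F_def p_def by (smt (verit) exp_le_cancel_iff)
    then show ?case by (simp add: m_real)
  qed
  moreover have "summable (\<lambda>k. exp (- (q * (2 ^ k * (2 * real n)) powr \<delta>)))"
    using q \<delta> n by (intro summable_exp_minus_dyadic) auto
  ultimately have "summable (\<lambda>k. prob (F k))" by (rule summable_comparison_test_ev)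
  then have "AE s in M. eventually (\<lambda>k. s \<in> space M - F k) sequentially"
    using F by (intro borel_cantelli_AE1) (auto simp: less_top[symmetric])
  then show ?thesis
  proof eventually_elim
    case (elim s)
    then have "eventually (\<lambda>k. \<exists>z\<in>annulus (m k). bridge V \<omega> (real (m k) powr \<beta>) c 0 x z s) sequentially"
      by (rule eventually_mono) (auto simp: F_def)
    then show ?case
      unfolding m_def n_def by (subst eventually_sequentially_Suc[symmetric])
  qed
qed

section \<open>Vanishing passage time\<close>

theorem theorem2p1:
  fixes M :: "'a measure"
    and V :: "int ^ 'd::finite \<Rightarrow> 'a \<Rightarrow> real"
    and \<omega> :: "(int ^ 'd) set \<Rightarrow> 'a \<Rightarrow> real"
    and \<nu>V \<nu>\<omega> :: "real measure"
    and \<alpha> \<gamma> \<theta> \<zeta> :: real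
    and x :: "int ^ 'd"
  assumes "ilrfpp M \<alpha> V \<omega> \<nu>V \<nu>\<omega>"
    and "standing_assumptions \<nu>V \<nu>\<omega> \<gamma> \<theta> \<zeta>"
    and "\<alpha> < real CARD('d) / \<gamma>"
    and "x \<noteq> 0"
  shows "(\<exists>y :: nat \<Rightarrow> 'a \<Rightarrow> int ^ 'd.
            (\<forall>k\<ge>1. y k \<in> measurable M (count_space UNIV) \<and>
                   (\<forall>s\<in>space M. y k s \<in> annulus (2 ^ k * l1norm x))) \<and>
            (AE s in M. (\<lambda>k. edge_time \<alpha> V \<omega> 0 (y k s) s + edge_time \<alpha> V \<omega> (y k s) x s)
                          \<longlonglongrightarrow> 0)) \<and>
         (AE s in M. first_passage_time \<alpha> V \<omega> 0 x s = 0)"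
proof -
  interpret ilrfpp M \<alpha> V \<omega> \<nu>V \<nu>\<omega> by fact
  have \<gamma>: "0 < \<gamma>" and \<theta>: "0 < \<theta>" and V_pos: "AE t in \<nu>V. 0 < t"
    and tail_V: "((\<lambda>t. ln (measure \<nu>V {t..}) / ln t) \<longlongrightarrow> - \<gamma>) at_top"
    and tail_\<omega>: "((\<lambda>t. ln (measure \<nu>\<omega> {..t}) / ln t) \<longlongrightarrow> \<theta>) (at_right 0)"
    using assms(2) by (auto simp: standing_assumptions_def)
  define n where "n = l1norm x"
  define m where "m k = 2 ^ k * n" for k
  have n: "0 < n" using assms(4) by (simp add: n_def zero_less_iff_neq_zero l1norm_eq_0_iff)
  have m_ge: "2 * n \<le> m k" if "1 \<le> k" for k
    using that power_increasing[of 1 k "2::nat"] by (simp add: m_def)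
  have avoid: "z \<noteq> 0 \<and> z \<noteq> x" if "1 \<le> k" "z \<in> annulus (m k)" for k z
    using annulus_avoids_endpoints[OF assms(4), of "m k"] m_ge[OF that(1)] that(2)
    by (auto simp: n_def)
  \<comment> \<open>With \<open>\<alpha> < \<beta>\<close> the weight of a bridge outgrows the factor \<open>m powr \<alpha>\<close>. With \<open>\<beta> g < d\<close>, where
      \<open>g > \<gamma>\<close> absorbs the error in the tail exponent, bridges exist at all large scales.\<close>
  obtain \<beta> where \<beta>: "\<alpha> < \<beta>" "\<beta> < real CARD('d) / \<gamma>" using assms(3) dense by blast
  then have "0 < \<beta>" using alpha_pos by simp
  with \<beta> \<gamma> have "\<gamma> < real CARD('d) / \<beta>" by (simp add: field_simps)
  then obtain g where g: "\<gamma> < g" "g < real CARD('d) / \<beta>" using dense by blast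
  then have \<beta>g: "\<beta> * g < real CARD('d)" using \<open>0 < \<beta>\<close> by (simp add: field_simps)
  obtain c where c: "0 < c" "measure \<nu>\<omega> {..c} \<noteq> 0"
    using exists_level_of_nonzero_prob[OF tail_\<omega> \<theta>] by metis
  let ?bridge = "\<lambda>k. bridge V \<omega> (real (m k) powr \<beta>) c 0 x"
  have "\<exists>y \<in> measurable M (count_space UNIV). (\<forall>s. y s \<in> annulus (m k)) \<and>
      (\<forall>s. (\<exists>z\<in>annulus (m k). ?bridge k z s) \<longrightarrow> ?bridge k (y s) s)" if "1 \<le> k" for k
  proof (rule exists_measurable_selection[OF finite_annulus])
    show "annulus (m k) \<noteq> ({} :: (int ^ 'd) set)"
      using m_ge[OF that] n by (intro annulus_nonempty) simp
    show "Measurable.pred M (?bridge k z)" if "z \<in> annulus (m k)" for z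
      using avoid[OF \<open>1 \<le> k\<close> that] by (intro measurable_bridge) auto
  qed
  then obtain y where y: "\<And>k. 1 \<le> k \<Longrightarrow> y k \<in> measurable M (count_space UNIV)"
    and y_annulus: "\<And>k s. 1 \<le> k \<Longrightarrow> y k s \<in> annulus (m k)"
    and y_bridge: "\<And>k s. 1 \<le> k \<Longrightarrow> \<exists>z\<in>annulus (m k). ?bridge k z s \<Longrightarrow> ?bridge k (y k s) s"
    by metis
  have y_avoid: "y k s \<noteq> 0" "y k s \<noteq> x" if "1 \<le> k" for k s
    using avoid[OF that y_annulus[OF that]] by auto
  let ?cost = "\<lambda>s k. edge_time \<alpha> V \<omega> 0 (y k s) s + edge_time \<alpha> V \<omega> (y k s) x s"
  have "AE s in M. eventually (\<lambda>k. \<exists>z\<in>annulus (m k). ?bridge k z s) sequentially"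
    unfolding m_def n_def
    using polynomial_tail_lower_bound[OF tail_V \<gamma> g(1)] c(2) assms(4) \<open>0 < \<beta>\<close> \<beta>g
    by (intro AE_eventually_bridge) (auto simp: zero_less_measure_iff)
  then have main: "AE s in M. ?cost s \<longlonglongrightarrow> 0 \<and> first_passage_time \<alpha> V \<omega> 0 x s = 0"
    using AE_V_pos[OF V_pos] AE_\<omega>_nonneg
  proof eventually_elim
    case (elim s)
    have V: "0 < V v s" for v using elim by simp
    have \<omega>: "0 \<le> \<omega> e s" if "e \<in> edges" for e using elim that by simp
    define h where "h = 1 / V 0 s + 1 / V x s"
    have "eventually (\<lambda>k. 0 \<le> ?cost s k) sequentially"
      using eventually_ge_at_top[of 1]
    proof eventually_elim
      case (elim k)
      then show ?case using y_avoid[OF elim] by (intro add_nonneg_nonneg edge_time_nonneg V \<omega>) auto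
    qed
    moreover have "eventually (\<lambda>k. ?cost s k \<le> (3 * real (m k)) powr \<alpha> * c / real (m k) powr \<beta> * h) sequentially"
      using elim(1) eventually_ge_at_top[of 1]
    proof eventually_elim
      case (elim k)
      have "l1norm (y k s) < 2 * m k" using y_annulus[OF elim(2)] by (simp add: annulus_def)
      moreover from this have "l1norm (y k s - x) \<le> 3 * m k"
        using l1norm_diff_le[of "y k s" x] m_ge[OF elim(2)] by (simp add: n_def)
      ultimately have "real (l1norm (0 - y k s)) \<le> 3 * real (m k)" "real (l1norm (y k s - x)) \<le> 3 * real (m k)"
        using l1norm_minus_commute[of 0 "y k s"] by auto
      moreover have "0 < real (m k) powr \<beta>" using m_ge[OF elim(2)] n by simp
      ultimately show ?case
        unfolding h_def using y_bridge[OF elim(2,1)] y_avoid[OF elim(2)] alpha_pos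
        by (intro bridge_cost_le V \<omega>) auto
    qed
    moreover have "(\<lambda>k. (3 * real (m k)) powr \<alpha> * c / real (m k) powr \<beta> * h) \<longlonglongrightarrow> 0"
      unfolding m_def of_nat_mult of_nat_power of_nat_numeral
      using n \<beta>(1) alpha_pos by real_asymp
    ultimately have cost: "?cost s \<longlonglongrightarrow> 0" by (rule tendsto_sandwich[OF _ _ tendsto_const])
    have "first_passage_time \<alpha> V \<omega> 0 x s \<le> 0"
    proof (rule tendsto_lowerbound)
      show "(\<lambda>k. ereal (?cost s k)) \<longlonglongrightarrow> 0" using cost by (simp add: zero_ereal_def)
      show "eventually (\<lambda>k. first_passage_time \<alpha> V \<omega> 0 x s \<le> ereal (?cost s k)) sequentially"
        using eventually_ge_at_top[of 1]
      proof eventually_elim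
        case (elim k)
        then show ?case
          using y_avoid[OF elim, of s] assms(4)
          by (intro first_passage_time_le_two_edges) auto
      qed
    qed simp
    then show ?case using cost first_passage_time_nonneg[of V s \<omega>] V \<omega>
      by (auto intro!: antisym)
  qed
  show ?thesis
  proof (intro conjI exI[of _ y] allI impI ballI)
    show "AE s in M. ?cost s \<longlonglongrightarrow> 0" using main by eventually_elim simp
    show "AE s in M. first_passage_time \<alpha> V \<omega> 0 x s = 0" using main by eventually_elim simp
  qed (use y y_annulus in \<open>auto simp: m_def n_def\<close>)
qed

end
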